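(* If $\mathcal{C}\subseteq T_1$ is a binary clone containing $\mathcal{O}^{(1)}$, then either $\mathcal{C}=T_1$ or $\mathcal{C}\subseteq T_2$. Hence $T_1\cap T_2$ is the unique coatom in the interval $[\mathcal{O}^{(1)},T_1]$ of the lattice of binary clones, and every binary clone in this interval, except for $T_1$ itself, is included in $T_1\cap T_2$.
   Context: $\mathbb{N}=\{0,1,2,\dots\}$. A binary clone (on $\mathbb{N}$) is a set $\mathcal{C}$ of functions $f:\mathbb{N}^2\to\mathbb{N}$ which contains the two projections and is closed under composition: if $f,g,h\in\mathcal{C}$, then the function $(x,y)\mapsto f(g(x,y),h(x,y))$ is in $\mathcal{C}$. Binary clones are ordered by inclusion. $\mathcal{O}^{(1)}$ denotes the set of unary functions $u:\mathbb{N}\to\mathbb{N}$, identified with the set of essentially unary functions; thus, for binary clones, "containing $\mathcal{O}^{(1)}$" means containing all functions $(x,y)\mapsto u(x)$ and $(x,y)\mapsto u(y)$ with $u:\mathbb{N}\to\mathbb{N}$ arbitrary. The interval $[\mathcal{O}^{(1)},T_1]$ consists of all binary clones $\mathcal{C}$ with $\mathcal{O}^{(1)}\subseteq\mathcal{C}\subseteq T_1$; a coatom of it is a maximal element of $[\mathcal{O}^{(1)},T_1]\setminus\{T_1\}$. A function $f:\mathbb{N}\times\mathbb{N}\to\mathbb{N}$ is almost unary if there is $F:\mathbb{N}\to\mathbb{N}$ with $f(x,y)\le F(x)$ for all $x,y$, or there is $F:\mathbb{N}\to\mathbb{N}$ with $f(x,y)\le F(y)$ for all $x,y$. $T_1$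 is the set of all almost unary functions; it is a binary clone containing $\mathcal{O}^{(1)}$. Let $\Delta=\{(x,y)\in\mathbb{N}^2:x>y\}$, $\nabla=\{(x,y)\in\mathbb{N}^2:x<y\}$, and for $S_1,S_2\subseteq\mathbb{N}$ let $\Delta_{S_1,S_2}=\Delta\cap(S_1\times S_2)$, $\nabla_{S_1,S_2}=\nabla\cap(S_1\times S_2)$. For infinite $S_1,S_2\subseteq\mathbb{N}$, a function $g:\Delta_{S_1,S_2}\to\mathbb{N}$ or $g:\nabla_{S_1,S_2}\to\mathbb{N}$ is canonical if one of the following holds: (1) $g$ is constant; (2) there is a 1-1 function $G:S_1\to\mathbb{N}$ with $g(x,y)=G(x)$ for all $(x,y)\in\mathrm{dom}(g)$; (3) there is a 1-1 function $G:S_2\to\mathbb{N}$ with $g(x,y)=G(y)$ for all $(x,y)\in\mathrm{dom}(g)$; (4) $g$ is 1-1. A function $f:\mathbb{N}\times\mathbb{N}\to\mathbb{N}$ is canonical on $S_1\times S_2$ (with $S_1,S_2$ infinite) if both restrictions $f|_{\Delta_{S_1,S_2}}$ and $f|_{\nabla_{S_1,S_2}}$ are canonical (not necessarily of the same kind), and moreover either the ranges of these two restrictions are disjoint, or $S_1=S_2$ and $f(x,y)=f(y,x)$ for all $x,y\in S_1$. A function $f:\mathbb{N}\times\mathbb{N}\to\mathbb{N}$ is nowhere injective if, whenever $f$ is canonical on $S_1\times S_2$ (for infinite $S_1,S_2$), neither $f|_{\Delta_{S_1,S_2}}$ nor $f|_{\nabla_{S_1,S_2}}$ is 1-1. $T_2$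 is the set of all nowhere injective functions; it is a binary clone containing $\mathcal{O}^{(1)}$. *)

theory Defs
  imports Main
begin

type_synonym binop = "nat \<times> nat \<Rightarrow> nat"

definition binary_clone :: "binop set \<Rightarrow> bool" where
  "binary_clone C \<longleftrightarrow> fst \<in> C \<and> snd \<in> C \<and>
     (\<forall>f\<in>C. \<forall>g\<in>C. \<forall>h\<in>C. (\<lambda>(x, y). f (g (x, y), h (x, y))) \<in> C)"

text \<open>Unary functions enter binary clones through the essentially unary functions.\<close>

definition essentially_unary :: "binop set" where
  "essentially_unary =
     {f. \<exists>u :: nat \<Rightarrow> nat. (\<forall>x y. f (x, y) = u x) \<or> (\<forall>x y. f (x, y) = u y)}"

definition clone_interval :: "binop set \<Rightarrow> binop set \<Rightarrow> binop set set" where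
  "clone_interval A B = {C. binary_clone C \<and> A \<subseteq> C \<and> C \<subseteq> B}"

definition coatom_in_interval :: "binop set \<Rightarrow> binop set \<Rightarrow> binop set \<Rightarrow> bool" where
  "coatom_in_interval A B M \<longleftrightarrow> M \<in> clone_interval A B - {B} \<and>
     (\<forall>C \<in> clone_interval A B - {B}. M \<subseteq> C \<longrightarrow> C = M)"

definition almost_unary :: "binop \<Rightarrow> bool" where
  "almost_unary f \<longleftrightarrow>
     (\<exists>F :: nat \<Rightarrow> nat. \<forall>x y. f (x, y) \<le> F x) \<or> (\<exists>F :: nat \<Rightarrow> nat. \<forall>x y. f (x, y) \<le> F y)"

definition T1 :: "binop set" where
  "T1 = {f. almost_unary f}"

definition Delta :: "nat set \<Rightarrow> nat set \<Rightarrow> (nat \<times> nat) set" where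
  "Delta S1 S2 = {(x, y). x > y} \<inter> S1 \<times> S2"

definition Nabla :: "nat set \<Rightarrow> nat set \<Rightarrow> (nat \<times> nat) set" where
  "Nabla S1 S2 = {(x, y). x < y} \<inter> S1 \<times> S2"

text \<open>The restriction of \<open>g\<close> to \<open>D\<close> is canonical, where \<open>D\<close> is \<open>Delta S1 S2\<close> or \<open>Nabla S1 S2\<close>.
  The partial function is modelled by the total function \<open>g\<close> and its domain \<open>D\<close>.
  In the second and third clauses \<open>G\<close> has to be injective on all of \<open>S1\<close> (\<open>S2\<close>), not only on the
  projection of \<open>D\<close>.\<close>

definition canonical_restr :: "nat set \<Rightarrow> nat set \<Rightarrow> (nat \<times> nat) set \<Rightarrow> binop \<Rightarrow> bool" where
  "canonical_restr S1 S2 D g \<longleftrightarrow>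
     (\<exists>c. \<forall>(x, y) \<in> D. g (x, y) = c) \<or>
     (\<exists>G :: nat \<Rightarrow> nat. inj_on G S1 \<and> (\<forall>(x, y) \<in> D. g (x, y) = G x)) \<or>
     (\<exists>G :: nat \<Rightarrow> nat. inj_on G S2 \<and> (\<forall>(x, y) \<in> D. g (x, y) = G y)) \<or>
     inj_on g D"

definition canonical_on :: "nat set \<Rightarrow> nat set \<Rightarrow> binop \<Rightarrow> bool" where
  "canonical_on S1 S2 f \<longleftrightarrow> infinite S1 \<and> infinite S2 \<and>
     canonical_restr S1 S2 (Delta S1 S2) f \<and>
     canonical_restr S1 S2 (Nabla S1 S2) f \<and>
     (f ` Delta S1 S2 \<inter> f ` Nabla S1 S2 = {} \<or>
      S1 = S2 \<and> (\<forall>x\<in>S1. \<forall>y\<in>S1. f (x, y) = f (y, x)))"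

definition nowhere_injective :: "binop \<Rightarrow> bool" where
  "nowhere_injective f \<longleftrightarrow>
     (\<forall>S1 S2. canonical_on S1 S2 f \<longrightarrow>
        \<not> inj_on f (Delta S1 S2) \<and> \<not> inj_on f (Nabla S1 S2))"

definition T2 :: "binop set" where
  "T2 = {f. nowhere_injective f}"

end

theory Submission
  imports Defs "HOL-Library.Ramsey" "HOL-Library.Nat_Bijection"
begin

text \<open>Let \<open>f\<close> be almost unary but not nowhere injective, say \<open>f (x, y) \<le> F x\<close>. Then \<open>f\<close> is injective
  on some \<open>\<Delta>\<close> and takes other values on the corresponding \<open>\<nabla>\<close>. Substituting two interleaved
  sequences gives \<open>p (x, y)\<close>, injective for \<open>x > y\<close> and recognisably different for \<open>x \<le> y\<close>. Applying
  unary functions to \<open>p (y, x)\<close> and \<open>p (x + 1, y)\<close> yields any \<open>g\<close> on \<open>x < y\<close> and on \<open>y \<le> x\<close>, and if \<open>g\<close>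
  is bounded in terms of \<open>x\<close>, then \<open>p\<close> can also glue the two halves together. So \<open>f\<close> generates \<open>T1\<close>.

  That \<open>T1 \<inter> T2\<close> is closed under composition is Ramsey theory. For almost unary \<open>f\<close>, being in \<open>T2\<close>
  means not being injective on any infinite \<open>\<Delta>\<close> or \<open>\<nabla>\<close>. If \<open>f (g, h)\<close> is injective on some \<open>\<Delta>\<close>, then
  by the Erdos-Rado theorem either \<open>g\<close> or \<open>h\<close> is injective on a smaller one, or \<open>g\<close> and \<open>h\<close> depend on
  one variable each, injectively, which makes \<open>f\<close> itself injective on some \<open>\<Delta>\<close> or \<open>\<nabla>\<close>.\<close>

section \<open>Ramsey theory\<close>

lemma sorted_list_of_increasing_quadruple:
  fixes a b c d :: nat
  assumes "a < b" "b < c" "c < d"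
  shows "sorted_list_of_set {a, b, c, d} = [a, b, c, d]" "card {a, b, c, d} = 4"
  using assms sorted_list_of_set.idem_if_sorted_distinct[of "[a, b, c, d]"] by simp_all

text \<open>The property becomes a 2-colouring of 4-element sets, evaluated on their increasing
  enumeration; enumerating the homogeneous set then yields the subsequence \<open>r\<close>.\<close>

lemma ramsey_quadruples:
  fixes P :: "nat \<Rightarrow> nat \<Rightarrow> nat \<Rightarrow> nat \<Rightarrow> bool"
  obtains r t where "strict_mono (r :: nat \<Rightarrow> nat)"
    "\<And>w x y z. w < x \<Longrightarrow> x < y \<Longrightarrow> y < z \<Longrightarrow> P (r w) (r x) (r y) (r z) = t"
proof -
  define q where "q l \<longleftrightarrow> P (l ! 0) (l ! 1) (l ! 2) (l ! 3)" for l
  define c where "c X = (if q (sorted_list_of_set X) then 1 else 0 :: nat)" for X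
  have "\<exists>Y t. Y \<subseteq> UNIV \<and> infinite Y \<and> t < 2 \<and> (\<forall>X. X \<subseteq> Y \<and> finite X \<and> card X = 4 \<longrightarrow> c X = t)"
    by (rule Ramsey) (auto simp: c_def)
  then obtain Y t where Y: "infinite Y" "\<forall>X. X \<subseteq> Y \<and> finite X \<and> card X = 4 \<longrightarrow> c X = t"
    by (elim exE conjE)
  let ?r = "enumerate Y"
  have mono: "strict_mono ?r"
    using Y(1) by (simp add: strict_mono_enumerate)
  have "P (?r w) (?r x) (?r y) (?r z) = (t = 1)" if "w < x" "x < y" "y < z" for w x y z
  proof -
    have less: "?r w < ?r x" "?r x < ?r y" "?r y < ?r z"
      using that mono by (auto simp: strict_mono_def)
    let ?X = "{?r w, ?r x, ?r y, ?r z}"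
    have "?X \<subseteq> Y" using Y(1) by (simp add: enumerate_in_set)
    then have "c ?X = t"
      using sorted_list_of_increasing_quadruple(2)[OF less] by (intro Y(2)[rule_format]) simp
    then show ?thesis
      unfolding c_def q_def sorted_list_of_increasing_quadruple(1)[OF less]
      by (auto split: if_splits)
  qed
  with mono show thesis by (rule that)
qed

text \<open>Four indices suffice to compare two index pairs in any relative position; relations
  between fewer indices ignore the last ones.\<close>

definition homogeneous :: "(nat \<Rightarrow> nat \<Rightarrow> nat \<Rightarrow> nat \<Rightarrow> bool) \<Rightarrow> bool" where
  "homogeneous P \<longleftrightarrow> (\<exists>t. \<forall>w x y z. w < x \<longrightarrow> x < y \<longrightarrow> y < z \<longrightarrow> P w x y z = t)"

lemma homogeneousE:
  assumes "homogeneous P"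
  obtains t where "\<And>w x y z. w < x \<Longrightarrow> x < y \<Longrightarrow> y < z \<Longrightarrow> P w x y z = t"
  using assms unfolding homogeneous_def by blast

lemma homogeneous_subseq:
  assumes "homogeneous P" "strict_mono r"
  shows "homogeneous (\<lambda>w x y z. P (r w) (r x) (r y) (r z))"
  using assms(1) strict_monoD[OF assms(2)] unfolding homogeneous_def by metis

text \<open>The sequence is thinned once per relation; homogeneity already reached survives further
  thinning.\<close>

lemma ramsey_quadruples_finite:
  fixes \<P> :: "(nat \<Rightarrow> nat \<Rightarrow> nat \<Rightarrow> nat \<Rightarrow> bool) set"
  assumes "finite \<P>"
  shows "\<exists>r :: nat \<Rightarrow> nat. strict_mono r \<and>
    (\<forall>P\<in>\<P>. homogeneous (\<lambda>w x y z. P (r w) (r x) (r y) (r z)))"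
  using assms
proof (induction \<P>)
  case empty
  have "strict_mono (\<lambda>n :: nat. n)" by (simp add: strict_mono_def)
  then show ?case by blast
next
  case (insert Q \<P>)
  then obtain r :: "nat \<Rightarrow> nat" where r: "strict_mono r"
    "\<And>P. P \<in> \<P> \<Longrightarrow> homogeneous (\<lambda>w x y z. P (r w) (r x) (r y) (r z))"
    by blast
  obtain s where s: "strict_mono (s :: nat \<Rightarrow> nat)"
    "homogeneous (\<lambda>w x y z. Q (r (s w)) (r (s x)) (r (s y)) (r (s z)))"
    using ramsey_quadruples[of "\<lambda>w x y z. Q (r w) (r x) (r y) (r z)"]
    unfolding homogeneous_def by metis
  have "\<forall>P\<in>insert Q \<P>. homogeneous (\<lambda>w x y z. P (r (s w)) (r (s x)) (r (s y)) (r (s z)))"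
    using s(2) homogeneous_subseq[OF r(2) s(1)] by blast
  moreover have "strict_mono (\<lambda>i. r (s i))"
    using r(1) s(1) by (simp add: strict_mono_def)
  ultimately show ?case by blast
qed

section \<open>The Erdos-Rado canonical theorem for pairs\<close>

definition canonical_pairs :: "(nat \<Rightarrow> nat \<Rightarrow> nat) \<Rightarrow> bool" where
  "canonical_pairs d \<longleftrightarrow>
     (\<exists>c. \<forall>i j. i < j \<longrightarrow> d i j = c) \<or>
     (\<exists>G. inj G \<and> (\<forall>i j. i < j \<longrightarrow> d i j = G i)) \<or>
     (\<exists>G. inj G \<and> (\<forall>i j. i < j \<longrightarrow> d i j = G j)) \<or>
     inj_on (\<lambda>(i, j). d i j) {(i, j). i < j}"

lemma canonical_pairs_subseq:
  assumes "canonical_pairs d" "strict_mono r"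
  shows "canonical_pairs (\<lambda>i j. d (r i) (r j))"
proof -
  note less = strict_monoD[OF assms(2)] and inj = strict_mono_imp_inj_on[OF assms(2)]
  have "inj_on (\<lambda>(i, j). d (r i) (r j)) {(i, j). i < j}"
    if "inj_on (\<lambda>(i, j). d i j) {(i, j). i < j}"
  proof (rule inj_onI, clarify)
    fix i j k l assume "i < j" "k < l" "d (r i) (r j) = d (r k) (r l)"
    then have "(r i, r j) = (r k, r l)"
      using inj_onD[OF that, of "(r i, r j)" "(r k, r l)"] less by auto
    then show "i = k \<and> j = l" using inj by (simp add: inj_eq)
  qed
  note inj_case = this
  have inj_comp: "inj (\<lambda>i. G (r i))" if "inj G" for G :: "nat \<Rightarrow> nat"
    using inj_compose[OF that inj] by (simp add: comp_def)
  show ?thesis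
    using assms(1) unfolding canonical_pairs_def
  proof (elim disjE exE conjE, goal_cases)
    case (1 c)
    then show ?case using less by auto
  next
    case (2 G)
    then have "inj (\<lambda>i. G (r i)) \<and> (\<forall>i j. i < j \<longrightarrow> d (r i) (r j) = G (r i))"
      using inj_comp less by auto
    then have "\<exists>G. inj G \<and> (\<forall>i j. i < j \<longrightarrow> d (r i) (r j) = G i)"
      by (rule exI[of _ "\<lambda>i. G (r i)"])
    then show ?case by blast
  next
    case (3 G)
    then have "inj (\<lambda>i. G (r i)) \<and> (\<forall>i j. i < j \<longrightarrow> d (r i) (r j) = G (r j))"
      using inj_comp less by auto
    then have "\<exists>G. inj G \<and> (\<forall>i j. i < j \<longrightarrow> d (r i) (r j) = G j)"
      by (rule exI[of _ "\<lambda>i. G (r i)"])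
    then show ?case by blast
  next
    case 4
    then have "inj_on (\<lambda>(i, j). d (r i) (r j)) {(i, j). i < j}" by (rule inj_case)
    then show ?case by blast
  qed
qed

text \<open>Two different pairs either share an index, in three possible ways, or are separated,
  crossing or nested. Ramsey's theorem decides for each of these six positions whether the values
  agree; the first two answers, \<open>f1\<close> and \<open>f2\<close>, determine the canonical
  type.\<close>

lemma erdos_rado_pairs:
  obtains r where "strict_mono (r :: nat \<Rightarrow> nat)" "canonical_pairs (\<lambda>i j. d (r i) (r j))"
proof -
  let ?\<P> = "{\<lambda>w x y z. d w x = d w y, \<lambda>w x y z. d w y = d x y, \<lambda>w x y z. d w x = d x y,
    \<lambda>w x y z. d w x = d y z, \<lambda>w x y z. d w y = d x z, \<lambda>w x y z. d w z = d x y}"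
  have "finite ?\<P>" by simp
  from ramsey_quadruples_finite[OF this] obtain r :: "nat \<Rightarrow> nat" where r: "strict_mono r"
    and hom: "\<forall>P\<in>?\<P>. homogeneous (\<lambda>w x y z. P (r w) (r x) (r y) (r z))"
    by blast
  define e where "e i j = d (r i) (r j)" for i j
  have h:
    "homogeneous (\<lambda>w x y z. e w x = e w y)"
    "homogeneous (\<lambda>w x y z. e w y = e x y)"
    "homogeneous (\<lambda>w x y z. e w x = e x y)"
    "homogeneous (\<lambda>w x y z. e w x = e y z)"
    "homogeneous (\<lambda>w x y z. e w y = e x z)"
    "homogeneous (\<lambda>w x y z. e w z = e x y)"
    using hom unfolding e_def by simp_all
  obtain f1 where F1': "\<And>w x y z. w < x \<Longrightarrow> x < y \<Longrightarrow> y < z \<Longrightarrow> (e w x = e w y) = f1"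
    using h(1) by (rule homogeneousE) blast
  obtain f2 where F2': "\<And>w x y z. w < x \<Longrightarrow> x < y \<Longrightarrow> y < z \<Longrightarrow> (e w y = e x y) = f2"
    using h(2) by (rule homogeneousE) blast
  obtain f3 where F3': "\<And>w x y z. w < x \<Longrightarrow> x < y \<Longrightarrow> y < z \<Longrightarrow> (e w x = e x y) = f3"
    using h(3) by (rule homogeneousE) blast
  obtain e1 where E1: "\<And>w x y z. w < x \<Longrightarrow> x < y \<Longrightarrow> y < z \<Longrightarrow> (e w x = e y z) = e1"
    using h(4) by (rule homogeneousE) blast
  obtain e2 where E2: "\<And>w x y z. w < x \<Longrightarrow> x < y \<Longrightarrow> y < z \<Longrightarrow> (e w y = e x z) = e2"
    using h(5) by (rule homogeneousE) blast
  obtain e3 where E3: "\<And>w x y z. w < x \<Longrightarrow> x < y \<Longrightarrow> y < z \<Longrightarrow> (e w z = e x y) = e3"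
    using h(6) by (rule homogeneousE) blast
  \<comment> \<open>The fourth index does not occur in these relations, so the successor of the
    third is inserted as a dummy.\<close>
  note F1 = F1'[OF _ _ lessI] and F2 = F2'[OF _ _ lessI] and F3 = F3'[OF _ _ lessI]
  consider "f1" "f2" | "f1" "\<not> f2" | "\<not> f1" "f2" | "\<not> f1" "\<not> f2" by blast
  then show thesis
  proof cases
    case 1
    have "e i j = e 0 1" if "i < j" for i j
    proof -
      have "e i j = e 0 j" using F2[of 0 i j] 1 that by (cases "i = 0") auto
      also have "\<dots> = e 0 1" using F1[of 0 1 j] 1 that by (cases "j = 1") auto
      finally show ?thesis .
    qed
    then have "canonical_pairs e" unfolding canonical_pairs_def by blast
    with r that show thesis unfolding e_def by blast
  next
    case 2
    have G: "e i j = e i (Suc i)" if "i < j" for i j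
      using F1[of i "Suc i" j] 2 that by (cases "j = Suc i") auto
    have "inj (\<lambda>i. e i (Suc i))"
    proof (rule linorder_injI)
      fix i j :: nat assume ij: "i < j"
      then show "e i (Suc i) \<noteq> e j (Suc j)"
        using F2[of i j "Suc j"] G[of i "Suc j"] 2 by simp
    qed
    with G have "canonical_pairs e" unfolding canonical_pairs_def by blast
    with r that show thesis unfolding e_def by blast
  next
    case 3
    \<comment> \<open>The values depend on the second index only and are read off in row
      \<open>0\<close>. That row is meaningful only for second index at least \<open>1\<close>,
      hence the shift of the sequence by one.\<close>
    have "e (Suc i) (Suc j) = e 0 (Suc j)" if "i < j" for i j
      using F2[of 0 "Suc i" "Suc j"] 3 that by auto
    moreover have "inj (\<lambda>j. e 0 (Suc j))"
      by (rule linorder_injI) (use F1[of 0] 3 in simp)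
    ultimately have "canonical_pairs (\<lambda>i j. e (Suc i) (Suc j))"
      unfolding canonical_pairs_def by blast
    moreover have "strict_mono (\<lambda>i. r (Suc i))"
      using r by (simp add: strict_mono_def)
    ultimately show thesis using that unfolding e_def by blast
  next
    case 4
    \<comment> \<open>If one of the remaining four equalities held, two instances of it sharing one
      side would make two values in the same row agree, which \<open>\<not> f1\<close>
      forbids.\<close>
    have "\<not> f3" using F1[of 1 2 3] F3[of 0 1 2] F3[of 0 1 3] 4 by auto
    moreover have "\<not> e1" using F1[of 2 3 4] E1[of 0 1 2 3] E1[of 0 1 2 4] 4 by auto
    moreover have "\<not> e2" using F1[of 1 3 4] E2[of 0 1 2 3] E2[of 0 1 2 4] 4 by auto
    moreover have "\<not> e3" using F1[of 1 2 3] E3[of 0 1 2 4] E3[of 0 1 3 4] 4 by auto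
    ultimately have neq: "e i j \<noteq> e k l" if "i < j" "k < l" "i < k \<or> i = k \<and> j < l" for i j k l
      using that F1[of i j l] F2[of i k j] F3[of i j l] E1[of i j k l] E2[of i k j l] E3[of i k l j] 4
      by (metis linorder_neqE_nat)
    have "inj_on (\<lambda>(i, j). e i j) {(i, j). i < j}"
    proof (rule inj_onI, clarify)
      fix i j k l assume "i < j" "k < l" "e i j = e k l"
      then show "i = k \<and> j = l"
        using neq[of i j k l] neq[of k l i j] by (metis linorder_neqE_nat)
    qed
    then have "canonical_pairs e" unfolding canonical_pairs_def by blast
    with r that show thesis unfolding e_def by blast
  qed
qed

section \<open>Interleaved sequences\<close>

text \<open>This is \<open>a 0 < b 0 < a 1 < b 1 < \<dots>\<close>, so that half planes in the
  values become half planes in the indices, with the diagonal \<open>i = j\<close> on the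
  \<open>Nabla\<close> side.\<close>

definition interleaved :: "(nat \<Rightarrow> nat) \<Rightarrow> (nat \<Rightarrow> nat) \<Rightarrow> bool" where
  "interleaved a b \<longleftrightarrow> (\<forall>i j. (a i < b j \<longleftrightarrow> i \<le> j) \<and> (b j < a i \<longleftrightarrow> j < i))"

lemma interleaved_subseq:
  assumes "interleaved a b" "strict_mono r"
  shows "interleaved (\<lambda>i. a (r i)) (\<lambda>j. b (r j))"
  using assms(1) strict_mono_less[OF assms(2)] strict_mono_less_eq[OF assms(2)]
  unfolding interleaved_def by simp

lemma interleaved_strict_mono:
  assumes "interleaved a b"
  shows "strict_mono a" "strict_mono b"
proof -
  show "strict_mono a"
    using assms unfolding interleaved_def strict_mono_def by (meson le_refl less_trans)
  show "strict_mono b"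
    using assms unfolding interleaved_def strict_mono_def by (meson le_refl less_trans)
qed

text \<open>Elements of the two sets are picked alternately, each above its predecessor.\<close>

lemma interleaved_exists:
  assumes "infinite S1" "infinite S2"
  obtains a b where "interleaved a b" "\<And>i. a i \<in> S1" "\<And>i. b i \<in> S2"
proof -
  have "\<exists>s. \<forall>n. (fst (s n) \<in> S1 \<and> snd (s n) \<in> S2 \<and> fst (s n) < snd (s n)) \<and>
      snd (s n) < fst (s (Suc n))"
  proof (rule dependent_nat_choice)
    obtain x where "x \<in> S1" using assms(1) infinite_imp_nonempty by blast
    moreover obtain y where "y \<in> S2" "x < y" using assms(2) infinite_nat_iff_unbounded by blast
    ultimately show "\<exists>p. fst p \<in> S1 \<and> snd p \<in> S2 \<and> fst p < snd p" by auto
  next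
    fix p :: "nat \<times> nat"
    obtain x where "x \<in> S1" "snd p < x" using assms(1) infinite_nat_iff_unbounded by blast
    moreover obtain y where "y \<in> S2" "x < y" using assms(2) infinite_nat_iff_unbounded by blast
    ultimately show "\<exists>q. (fst q \<in> S1 \<and> snd q \<in> S2 \<and> fst q < snd q) \<and> snd p < fst q" by auto
  qed
  then obtain s where s: "\<And>n. fst (s n) \<in> S1" "\<And>n. snd (s n) \<in> S2"
    "\<And>n. fst (s n) < snd (s n)" "\<And>n. snd (s n) < fst (s (Suc n))" by blast
  define a b where "a n = fst (s n)" and "b n = snd (s n)" for n
  have "strict_mono a" "strict_mono b"
    unfolding strict_mono_Suc_iff a_def b_def using s(3,4) less_trans by blast+
  note mono = this[THEN strict_mono_less_eq]
  have less: "a i < b j" if "i \<le> j" for i j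
    using s(3)[of j] that mono(1)[of i j] unfolding a_def b_def by linarith
  have gt: "b j < a i" if "j < i" for i j
    using s(4)[of j] that mono(1)[of "Suc j" i] unfolding a_def b_def by linarith
  have "interleaved a b"
    unfolding interleaved_def using less gt by (meson less_asym not_le)
  then show thesis using that s(1,2) unfolding a_def b_def by blast
qed

section \<open>Injectivity on half planes\<close>

lemma T1_swap: "f \<in> T1 \<Longrightarrow> f \<circ> prod.swap \<in> T1"
  unfolding T1_def almost_unary_def by auto

lemma swap_swap: "(f \<circ> prod.swap) \<circ> prod.swap = f"
  by (simp add: comp_assoc)

lemma swap_image_Delta: "prod.swap ` Delta S1 S2 = Nabla S2 S1"
  and swap_image_Nabla: "prod.swap ` Nabla S1 S2 = Delta S2 S1"
  unfolding Delta_def Nabla_def by (force simp: image_iff)+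

lemma inj_on_Delta_swap: "inj_on (f \<circ> prod.swap) (Delta S1 S2) \<longleftrightarrow> inj_on f (Nabla S2 S1)"
  using comp_inj_on_iff[of prod.swap "Delta S1 S2" f] by (simp add: swap_image_Delta)

lemma inj_on_Nabla_swap: "inj_on (f \<circ> prod.swap) (Nabla S1 S2) \<longleftrightarrow> inj_on f (Delta S2 S1)"
  using comp_inj_on_iff[of prod.swap "Nabla S1 S2" f] by (simp add: swap_image_Nabla)

text \<open>Swapping interchanges dependence on the first argument with dependence on the second,
  that is, the two middle cases of canonicity.\<close>

lemma canonical_restr_Delta_swap:
  "canonical_restr S1 S2 (Delta S1 S2) (f \<circ> prod.swap) \<longleftrightarrow> canonical_restr S2 S1 (Nabla S2 S1) f"
proof -
  have "(\<forall>(x, y)\<in>Delta S1 S2. P x y) \<longleftrightarrow> (\<forall>(y, x)\<in>Nabla S2 S1. P x y)" for P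
    unfolding Delta_def Nabla_def by auto
  note ball_swap = this[where P = "\<lambda>x y. (f \<circ> prod.swap) (x, y) = Q x y" for Q]
  show ?thesis
    unfolding canonical_restr_def inj_on_Delta_swap ball_swap
    by (simp only: comp_apply swap_simp) (rule disj_cong[OF refl] disj_left_commute)+
qed

lemma canonical_on_swap:
  assumes "canonical_on S1 S2 f"
  shows "canonical_on S2 S1 (f \<circ> prod.swap)"
proof -
  have "canonical_restr S2 S1 (Delta S2 S1) (f \<circ> prod.swap)"
    using assms unfolding canonical_restr_Delta_swap canonical_on_def by blast
  \<comment> \<open>This is the equivalence for \<open>Delta\<close> read backwards, for the swapped
    function.\<close>
  moreover have "canonical_restr S2 S1 (Nabla S2 S1) (f \<circ> prod.swap)"
    using assms unfolding canonical_restr_Delta_swap[symmetric] swap_swap canonical_on_def by blast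
  moreover have "(f \<circ> prod.swap) ` Delta S2 S1 = f ` Nabla S1 S2"
    "(f \<circ> prod.swap) ` Nabla S2 S1 = f ` Delta S1 S2"
    unfolding image_comp[symmetric] swap_image_Delta swap_image_Nabla by (rule refl)+
  ultimately show ?thesis
    using assms unfolding canonical_on_def by auto
qed

lemma T2_swap:
  assumes "f \<in> T2"
  shows "f \<circ> prod.swap \<in> T2"
proof -
  have "\<not> inj_on (f \<circ> prod.swap) (Delta S1 S2) \<and> \<not> inj_on (f \<circ> prod.swap) (Nabla S1 S2)"
    if "canonical_on S1 S2 (f \<circ> prod.swap)" for S1 S2
  proof -
    have "canonical_on S2 S1 f" using canonical_on_swap[OF that] unfolding swap_swap .
    then show ?thesis
      using assms unfolding inj_on_Delta_swap inj_on_Nabla_swap T2_def nowhere_injective_def by blast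
  qed
  then show ?thesis unfolding T2_def nowhere_injective_def by blast
qed

text \<open>Pigeonhole: infinitely many arguments compete for at most \<open>m + 1\<close>
  values.\<close>

lemma no_bounded_injective_row:
  fixes u :: "nat \<Rightarrow> nat"
  assumes "infinite S" "\<And>y. u y \<le> m"
  shows "\<not> inj_on u {y \<in> S. x < y}"
proof
  assume inj: "inj_on u {y \<in> S. x < y}"
  have "finite (u ` {y \<in> S. x < y})"
    by (rule finite_subset[of _ "{..m}"]) (use assms(2) in auto)
  then have "finite {y \<in> S. x < y}" using inj by (rule finite_imageD)
  then have "finite ({y \<in> S. x < y} \<union> {..x})" by simp
  then have "finite S" by (rule rev_finite_subset) auto
  with assms(1) show False by blast
qed

text \<open>For fixed \<open>y\<close> there are infinitely many \<open>x > y\<close> in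
  \<open>S1\<close>, and a bound \<open>F y\<close> would leave only finitely many values for them.
  So the bound of the almost unary \<open>f\<close> is in the first argument.\<close>

lemma bounded_by_first_if_inj_on_Delta:
  assumes "f \<in> T1" "infinite S1" "infinite S2" "inj_on f (Delta S1 S2)"
  obtains F where "\<And>x y. f (x, y) \<le> F x"
proof -
  have False if F: "\<And>x y. f (x, y) \<le> F y" for F
  proof -
    obtain y where "y \<in> S2" using assms(3) infinite_imp_nonempty by blast
    then have "inj_on (\<lambda>x. f (x, y)) {x \<in> S1. y < x}"
      using assms(4) unfolding inj_on_def Delta_def by auto
    then show False
      using no_bounded_injective_row[OF assms(2), of "\<lambda>x. f (x, y)" "F y"] F by simp
  qed
  then obtain F where "\<forall>x y. f (x, y) \<le> F x"
    using assms(1) unfolding T1_def almost_unary_def mem_Collect_eq by metis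
  then show thesis by (intro that[of F]) simp
qed

text \<open>Thinning out the two sets by Ramsey's theorem makes \<open>f\<close> canonical. The row and column
  indices are taken even and odd, respectively, so that no diagonal pairs remain.\<close>

lemma not_T2_if_inj_on_Delta:
  assumes "f \<in> T1" "infinite S1" "infinite S2" "inj_on f (Delta S1 S2)"
  shows "f \<notin> T2"
proof -
  obtain F where F: "\<And>x y. f (x, y) \<le> F x"
    using bounded_by_first_if_inj_on_Delta[OF assms] by blast
  obtain a0 b0 where ab0: "interleaved a0 b0" "\<And>i. a0 i \<in> S1" "\<And>i. b0 i \<in> S2"
    using interleaved_exists[OF assms(2,3)] by blast
  let ?q = "\<lambda>i j. f (a0 i, b0 j)"
  \<comment> \<open>The first two relations compare values at index pairs \<open>i < j\<close>, the
    \<open>Nabla\<close> side. The other four compare a value on the \<open>Delta\<close> side with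
    one on the \<open>Nabla\<close> side.\<close>
  let ?\<P> = "{\<lambda>w x y z. ?q w x = ?q w y, \<lambda>w x y z. ?q w y = ?q x y,
    \<lambda>w x y z. ?q y x = ?q w z, \<lambda>w x y z. ?q y w = ?q x z,
    \<lambda>w x y z. ?q x w = ?q y z, \<lambda>w x y z. ?q x w = ?q x z}"
  have "finite ?\<P>" by simp
  from ramsey_quadruples_finite[OF this] obtain r :: "nat \<Rightarrow> nat" where r: "strict_mono r"
    and hom: "\<forall>P\<in>?\<P>. homogeneous (\<lambda>w x y z. P (r w) (r x) (r y) (r z))"
    by blast
  define a b where "a i = a0 (r i)" and "b j = b0 (r j)" for i j
  have ab: "interleaved a b"
    unfolding a_def b_def using interleaved_subseq[OF ab0(1) r] .
  have in_S: "a i \<in> S1" "b i \<in> S2" for i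
    unfolding a_def b_def by (rule ab0)+
  have less: "a i < b j \<longleftrightarrow> i \<le> j" and greater: "b j < a i \<longleftrightarrow> j < i" for i j
    using ab unfolding interleaved_def by auto
  have inj_a: "inj a" and inj_b: "inj b"
    using interleaved_strict_mono[OF ab] by (auto intro: strict_mono_imp_inj_on)
  define p where "p i j = f (a i, b j)" for i j
  have h:
    "homogeneous (\<lambda>w x y z. p w x = p w y)"
    "homogeneous (\<lambda>w x y z. p w y = p x y)"
    "homogeneous (\<lambda>w x y z. p y x = p w z)"
    "homogeneous (\<lambda>w x y z. p y w = p x z)"
    "homogeneous (\<lambda>w x y z. p x w = p y z)"
    "homogeneous (\<lambda>w x y z. p x w = p x z)"
    using hom unfolding p_def a_def b_def by simp_all
  obtain t1 where H1: "\<And>w x y z. w < x \<Longrightarrow> x < y \<Longrightarrow> y < z \<Longrightarrow> (p w x = p w y) = t1"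
    using h(1) by (rule homogeneousE) blast
  obtain t2 where H2: "\<And>w x y z. w < x \<Longrightarrow> x < y \<Longrightarrow> y < z \<Longrightarrow> (p w y = p x y) = t2"
    using h(2) by (rule homogeneousE) blast
  obtain t3 where H3: "\<And>w x y z. w < x \<Longrightarrow> x < y \<Longrightarrow> y < z \<Longrightarrow> (p y x = p w z) = t3"
    using h(3) by (rule homogeneousE) blast
  obtain t4 where H4: "\<And>w x y z. w < x \<Longrightarrow> x < y \<Longrightarrow> y < z \<Longrightarrow> (p y w = p x z) = t4"
    using h(4) by (rule homogeneousE) blast
  obtain t5 where H5: "\<And>w x y z. w < x \<Longrightarrow> x < y \<Longrightarrow> y < z \<Longrightarrow> (p x w = p y z) = t5"
    using h(5) by (rule homogeneousE) blast
  obtain t6 where H6: "\<And>w x y z. w < x \<Longrightarrow> x < y \<Longrightarrow> y < z \<Longrightarrow> (p x w = p x z) = t6"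
    using h(6) by (rule homogeneousE) blast
  have inj: "i = i' \<and> j = j'" if "p i j = p i' j'" "j < i" "j' < i'" for i j i' j'
  proof -
    have "(a i, b j) = (a i', b j')"
      by (rule inj_onD[OF assms(4)])
        (use that in_S greater in \<open>auto simp: p_def Delta_def\<close>)
    then show ?thesis using inj_a inj_b by (simp add: inj_eq)
  qed
  \<comment> \<open>Row \<open>0\<close> is bounded by \<open>F (a 0)\<close>, so its entries cannot
    be pairwise different. Hence \<open>p i j\<close> depends only on \<open>i\<close> for
    \<open>i < j\<close>, and \<open>K\<close> is this dependence.\<close>
  have t1
  proof (rule ccontr)
    assume "\<not> t1"
    have "inj_on (p 0) {y \<in> UNIV. 0 < y}"
    proof (rule linorder_inj_onI)
      fix i j :: nat assume "i < j" "i \<in> {y \<in> UNIV. 0 < y}"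
      then show "p 0 i \<noteq> p 0 j" using H1[of 0 i j "Suc j"] \<open>\<not> t1\<close> by auto
    qed auto
    moreover have "p 0 y \<le> F (a 0)" for y unfolding p_def by (rule F)
    ultimately show False
      using no_bounded_injective_row[OF infinite_UNIV_nat, of "p 0" "F (a 0)" 0] by simp
  qed
  define K where "K i = p i (Suc i)" for i
  have K: "p i j = K i" if "i < j" for i j
    using H1[of i "Suc i" j "Suc j"] \<open>t1\<close> that unfolding K_def by (cases "j = Suc i") auto
  have K_const: "K i = K 0" if t2 for i
    using H2[of 0 i "Suc i" "Suc (Suc i)"] K[of 0 "Suc i"] K[of i "Suc i"] that
    by (cases "i = 0") auto
  have K_inj: "inj K" if "\<not> t2"
  proof (rule linorder_injI)
    fix i j :: nat assume "i < j"
    then show "K i \<noteq> K j"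
      using H2[of i j "Suc j" "Suc (Suc j)"] K[of i "Suc j"] K[of j "Suc j"] that by auto
  qed
  \<comment> \<open>Each of these equalities, applied twice with the same \<open>Nabla\<close>
    value, would identify two different values on the \<open>Delta\<close> side.\<close>
  have "\<not> t3" using H3[of 0 1 2 4] H3[of 0 1 3 4] inj[of 2 1 3 1] by auto
  have "\<not> t4" using H4[of 0 2 3 5] H4[of 1 2 3 5] inj[of 3 0 3 1] by auto
  have "\<not> t5" using H5[of 0 2 3 5] H5[of 1 2 3 5] inj[of 2 0 2 1] by auto
  have "\<not> t6" using H6[of 0 2 3 5] H6[of 1 2 3 5] inj[of 2 0 2 1] by auto
  \<comment> \<open>The four relations cover every position of \<open>k\<close> except
    \<open>k = j\<close>; the parities of the indices in \<open>R1\<close> and \<open>R2\<close>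
    exclude that one.\<close>
  have disj: "p i j \<noteq> K k" if ji: "j < i" and kj: "k \<noteq> j" for i j k
  proof -
    \<comment> \<open>\<open>K k\<close> can be read in any column beyond \<open>k\<close>; one
      beyond all indices involved fits the four relations.\<close>
    let ?z = "Suc (Suc (i + j + k))"
    have Kz: "K k = p k ?z" using K[of k ?z] by simp
    consider "k < j" | "j < k" "k < i" | "k = i" | "i < k"
      using kj by (metis linorder_neqE_nat)
    then show ?thesis
    proof cases
      case 1
      then show ?thesis using H3[of k j i ?z] ji \<open>\<not> t3\<close> Kz by simp
    next
      case 2
      then show ?thesis using H4[of j k i ?z] \<open>\<not> t4\<close> Kz by simp
    next
      case 3
      then show ?thesis using H6[of j i "Suc i" ?z] ji \<open>\<not> t6\<close> Kz by simp
    next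
      case 4
      then show ?thesis using H5[of j i k ?z] ji \<open>\<not> t5\<close> Kz by simp
    qed
  qed
  define R1 R2 where "R1 = range (\<lambda>n. a (2 * n))" and "R2 = range (\<lambda>n. b (Suc (2 * n)))"
  have "inj (\<lambda>n. a (2 * n))" "inj (\<lambda>n. b (Suc (2 * n)))"
    by (auto intro!: injI simp: inj_eq[OF inj_a] inj_eq[OF inj_b])
  then have inf: "infinite R1" "infinite R2"
    unfolding R1_def R2_def by (simp_all add: range_inj_infinite)
  have "R1 \<subseteq> S1" "R2 \<subseteq> S2"
    using in_S unfolding R1_def R2_def by (simp_all add: image_subset_iff)
  then have "Delta R1 R2 \<subseteq> Delta S1 S2"
    unfolding Delta_def by blast
  then have Delta_inj: "inj_on f (Delta R1 R2)"
    using assms(4) inj_on_subset by blast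
  have Nabla_val: "\<exists>i. x = a i \<and> even i \<and> f (x, y) = K i" if "(x, y) \<in> Nabla R1 R2" for x y
  proof -
    obtain m n where mn: "x = a (2 * m)" "y = b (Suc (2 * n))" "x < y"
      using \<open>(x, y) \<in> Nabla R1 R2\<close> unfolding Nabla_def R1_def R2_def by auto
    then have "2 * m < Suc (2 * n)" using less[of "2 * m" "Suc (2 * n)"] by presburger
    then show ?thesis using K[of "2 * m" "Suc (2 * n)"] mn unfolding p_def by auto
  qed
  have Delta_val: "\<exists>i j. j < i \<and> odd j \<and> f z = p i j" if z: "z \<in> Delta R1 R2" for z
  proof -
    obtain m n where "z = (a (2 * m), b (Suc (2 * n)))" "b (Suc (2 * n)) < a (2 * m)"
      using z unfolding Delta_def R1_def R2_def by auto
    then have "Suc (2 * n) < 2 * m" "f z = p (2 * m) (Suc (2 * n))"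
      unfolding greater p_def by simp_all
    then show ?thesis by (intro exI[of _ "2 * m"] exI[of _ "Suc (2 * n)"]) simp
  qed
  have Nabla_canonical: "canonical_restr R1 R2 (Nabla R1 R2) f"
  proof (cases t2)
    case True
    have "f (x, y) = K 0" if "(x, y) \<in> Nabla R1 R2" for x y
      using Nabla_val[OF that] K_const[OF True] by auto
    then show ?thesis unfolding canonical_restr_def by blast
  next
    case False
    have "inj_on (\<lambda>x. K (inv a x)) R1"
      unfolding R1_def using inj_a by (auto intro!: inj_onI simp: inj_eq[OF K_inj[OF False]])
    moreover have "f (x, y) = K (inv a x)" if "(x, y) \<in> Nabla R1 R2" for x y
      using Nabla_val[OF that] inj_a by auto
    ultimately show ?thesis unfolding canonical_restr_def by blast
  qed
  have "f ` Delta R1 R2 \<inter> f ` Nabla R1 R2 = {}"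
  proof -
    have "f z \<noteq> f (x, y)" if z: "z \<in> Delta R1 R2" and xy: "(x, y) \<in> Nabla R1 R2" for z x y
    proof -
      obtain i j where "j < i" "odd j" "f z = p i j" using Delta_val[OF z] by blast
      moreover obtain k where "even k" "f (x, y) = K k" using Nabla_val[OF xy] by blast
      ultimately show ?thesis using disj[of j i k] by metis
    qed
    then show ?thesis by auto
  qed
  then have "canonical_on R1 R2 f"
    using inf Delta_inj Nabla_canonical unfolding canonical_on_def
    by (simp add: canonical_restr_def[of _ _ "Delta R1 R2"])
  then show ?thesis using Delta_inj unfolding T2_def nowhere_injective_def by blast
qed

lemma not_inj_on_Delta:
  assumes "f \<in> T1 \<inter> T2" "infinite S1" "infinite S2"
  shows "\<not> inj_on f (Delta S1 S2)"
  using assms not_T2_if_inj_on_Delta by blast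

lemma not_inj_on_Nabla:
  assumes "f \<in> T1 \<inter> T2" "infinite S1" "infinite S2"
  shows "\<not> inj_on f (Nabla S1 S2)"
  using not_inj_on_Delta[of "f \<circ> prod.swap" S2 S1] assms T1_swap[of f] T2_swap[of f]
  unfolding inj_on_Delta_swap by simp

section \<open>Closure of the almost unary nowhere injective functions\<close>

text \<open>The index pairs \<open>i < j\<close> correspond exactly to the points
  \<open>(a j, b i)\<close> of \<open>Delta\<close>. The larger index goes with the first argument,
  because \<open>Delta\<close> lies where \<open>x > y\<close>.\<close>

lemma inj_on_Delta_if_inj_on_pairs:
  assumes ab: "interleaved a b" and inj: "inj_on (\<lambda>(i, j). g (a j, b i)) {(i, j). i < j}"
  shows "inj_on g (Delta (range a) (range b))"
proof (rule inj_onI)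
  have less: "b i < a j \<longleftrightarrow> i < j" for i j
    using ab unfolding interleaved_def by auto
  fix z z' assume "z \<in> Delta (range a) (range b)" "z' \<in> Delta (range a) (range b)"
    and eq: "g z = g z'"
  then obtain i j i' j' where z: "z = (a j, b i)" "i < j" "z' = (a j', b i')" "i' < j'"
    unfolding Delta_def using less by auto
  then have "(i, j) = (i', j')"
    using eq by (intro inj_onD[OF inj]) auto
  then show "z = z'" using z by simp
qed

lemma inj_on_pairs_if_inj_on_Delta:
  assumes ab: "interleaved a b" and "\<And>i. a i \<in> S1" "\<And>i. b i \<in> S2" and inj: "inj_on g (Delta S1 S2)"
  shows "inj_on (\<lambda>(i, j). g (a j, b i)) {(i, j). i < j}"
proof (rule inj_onI, clarify)
  have less: "b i < a j \<longleftrightarrow> i < j" for i j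
    using ab unfolding interleaved_def by auto
  fix i j i' j' assume "i < j" "i' < j'" "g (a j, b i) = g (a j', b i')"
  then have "(a j, b i) = (a j', b i')"
    using assms(2,3) less by (intro inj_onD[OF inj]) (auto simp: Delta_def)
  then show "i = i' \<and> j = j'"
    using interleaved_strict_mono[OF ab] by (simp add: strict_mono_eq)
qed

text \<open>\<open>G\<close> and \<open>H\<close> need not be monotone or interleaved. Thinning
  makes \<open>H\<close> at a later index exceed \<open>G\<close> at an earlier one, so a point of
  \<open>Delta\<close> can only come from indices \<open>i < j\<close>, where injectivity is
  known.\<close>

lemma inj_on_Delta_if_separated:
  fixes G H :: "nat \<Rightarrow> nat"
  assumes "inj G" "inj H" and inj: "inj_on (\<lambda>(i, j). f (G j, H i)) {(i, j). i < j}"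
  obtains S1 S2 where "infinite S1" "infinite S2" "inj_on f (Delta S1 S2)"
proof -
  obtain r t where r: "strict_mono (r :: nat \<Rightarrow> nat)"
    and hom: "\<And>w x y z. w < x \<Longrightarrow> x < y \<Longrightarrow> y < z \<Longrightarrow> (H (r x) \<le> G (r w)) = t"
    using ramsey_quadruples[of "\<lambda>w x y z. H x \<le> G w"] by metis
  have r_eq: "r i = r j \<longleftrightarrow> i = j" for i j
    using r by (rule strict_mono_eq)
  \<comment> \<open>Otherwise infinitely many values of the injective \<open>H\<close> would lie
    below the single number \<open>G (r 0)\<close>.\<close>
  have "\<not> t"
  proof
    assume t
    then have "H (r x) \<le> G (r 0)" if "0 < x" for x
      using hom[of 0 x "Suc x" "Suc (Suc x)"] that by simp
    then have "range (\<lambda>x. H (r (Suc x))) \<subseteq> {..G (r 0)}" by auto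
    then have "finite (range (\<lambda>x. H (r (Suc x))))"
      by (rule finite_subset) simp
    moreover have "inj (\<lambda>x. H (r (Suc x)))"
      by (rule injI) (simp add: inj_eq[OF assms(2)] r_eq)
    ultimately show False using range_inj_infinite by blast
  qed
  have less: "i < j" if "H (r i) < G (r j)" "i \<noteq> j" for i j
    using hom[of j i "Suc i" "Suc (Suc i)"] that \<open>\<not> t\<close> by fastforce
  \<comment> \<open>Different parities exclude equal indices, for which injectivity is not
    given.\<close>
  define S1 S2 where "S1 = range (\<lambda>n. G (r (2 * n)))" and "S2 = range (\<lambda>n. H (r (Suc (2 * n))))"
  have "inj (\<lambda>n. G (r (2 * n)))"
    by (rule injI) (simp add: inj_eq[OF assms(1)] r_eq)
  moreover have "inj (\<lambda>n. H (r (Suc (2 * n))))"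
    by (rule injI) (simp add: inj_eq[OF assms(2)] r_eq)
  ultimately have "infinite S1" "infinite S2"
    unfolding S1_def S2_def by (simp_all add: range_inj_infinite)
  moreover have "inj_on f (Delta S1 S2)"
  proof (rule inj_onI)
    have repr: "\<exists>i j. i < j \<and> z = (G (r j), H (r i))" if z: "z \<in> Delta S1 S2" for z
    proof -
      obtain m n where mn: "z = (G (r (2 * m)), H (r (Suc (2 * n))))"
        "H (r (Suc (2 * n))) < G (r (2 * m))"
        using z unfolding Delta_def S1_def S2_def by auto
      moreover have "Suc (2 * n) \<noteq> 2 * m" by presburger
      ultimately show ?thesis using less by blast
    qed
    fix z z' assume "z \<in> Delta S1 S2" "z' \<in> Delta S1 S2" and eq: "f z = f z'"
    then obtain i j i' j' where z: "z = (G (r j), H (r i))" "i < j"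
      "z' = (G (r j'), H (r i'))" "i' < j'"
      using repr by metis
    then have "(r i, r j) = (r i', r j')"
      using eq strict_monoD[OF r] by (intro inj_onD[OF inj]) auto
    then show "z = z'" using z by simp
  qed
  ultimately show thesis by (rule that)
qed

text \<open>Thinning once for \<open>g\<close> and once for \<open>h\<close> makes both canonical,
  and neither is injective. Since the composition distinguishes both indices, \<open>g\<close> and
  \<open>h\<close> depend on different ones, and \<open>inj_on_Delta_if_separated\<close> transfers
  injectivity to \<open>f\<close>.\<close>

lemma comp_not_inj_on_Delta:
  assumes f: "f \<in> T1 \<inter> T2" and g: "g \<in> T1 \<inter> T2" and h: "h \<in> T1 \<inter> T2"
    and "infinite S1" "infinite S2"
  shows "\<not> inj_on (\<lambda>z. f (g z, h z)) (Delta S1 S2)"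
proof
  assume inj: "inj_on (\<lambda>z. f (g z, h z)) (Delta S1 S2)"
  obtain a0 b0 where ab0: "interleaved a0 b0" "\<And>i. a0 i \<in> S1" "\<And>i. b0 i \<in> S2"
    using interleaved_exists[OF assms(4,5)] by blast
  obtain r where r: "strict_mono r" "canonical_pairs (\<lambda>i j. g (a0 (r j), b0 (r i)))"
    by (rule erdos_rado_pairs)
  obtain s where s: "strict_mono s" "canonical_pairs (\<lambda>i j. h (a0 (r (s j)), b0 (r (s i))))"
    by (rule erdos_rado_pairs)
  define a b where "a i = a0 (r (s i))" and "b i = b0 (r (s i))" for i
  have ab: "interleaved a b"
    unfolding a_def b_def by (intro interleaved_subseq[OF _ s(1)] interleaved_subseq[OF ab0(1) r(1)])
  have "infinite (range a)" "infinite (range b)"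
    using interleaved_strict_mono[OF ab] by (simp_all add: range_inj_infinite strict_mono_imp_inj_on)
  note not_inj = not_inj_on_Delta[OF _ this]
  have "canonical_pairs (\<lambda>i j. g (a j, b i))"
    unfolding a_def b_def by (rule canonical_pairs_subseq[OF r(2) s(1)])
  moreover have "\<not> inj_on (\<lambda>(i, j). g (a j, b i)) {(i, j). i < j}"
    using inj_on_Delta_if_inj_on_pairs[OF ab] not_inj[OF g] by blast
  ultimately have g_cases: "(\<exists>c. \<forall>i j. i < j \<longrightarrow> g (a j, b i) = c) \<or>
     (\<exists>G. inj G \<and> (\<forall>i j. i < j \<longrightarrow> g (a j, b i) = G i)) \<or>
     (\<exists>G. inj G \<and> (\<forall>i j. i < j \<longrightarrow> g (a j, b i) = G j))"
    unfolding canonical_pairs_def by blast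
  have "canonical_pairs (\<lambda>i j. h (a j, b i))"
    unfolding a_def b_def by (rule s(2))
  moreover have "\<not> inj_on (\<lambda>(i, j). h (a j, b i)) {(i, j). i < j}"
    using inj_on_Delta_if_inj_on_pairs[OF ab] not_inj[OF h] by blast
  ultimately have h_cases: "(\<exists>c. \<forall>i j. i < j \<longrightarrow> h (a j, b i) = c) \<or>
     (\<exists>H. inj H \<and> (\<forall>i j. i < j \<longrightarrow> h (a j, b i) = H i)) \<or>
     (\<exists>H. inj H \<and> (\<forall>i j. i < j \<longrightarrow> h (a j, b i) = H j))"
    unfolding canonical_pairs_def by blast
  have k_inj: "inj_on (\<lambda>(i, j). f (g (a j, b i), h (a j, b i))) {(i, j). i < j}"
    by (rule inj_on_pairs_if_inj_on_Delta[OF ab _ _ inj]) (simp_all add: a_def b_def ab0)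
  \<comment> \<open>Points sharing one index show that the pair of inner values depends on the
    larger index and, next, on the smaller one. This rules out seven of the nine combinations of
    types.\<close>
  have dep_max: "(g (a 1, b 0), h (a 1, b 0)) \<noteq> (g (a 2, b 0), h (a 2, b 0))"
    using inj_onD[OF k_inj, of "(0, 1)" "(0, 2)"] by auto
  have dep_min: "(g (a 2, b 0), h (a 2, b 0)) \<noteq> (g (a 2, b 1), h (a 2, b 1))"
    using inj_onD[OF k_inj, of "(0, 2)" "(1, 2)"] by auto
  consider G H where "inj G" "inj H" "\<And>i j. i < j \<Longrightarrow> g (a j, b i) = G j"
      "\<And>i j. i < j \<Longrightarrow> h (a j, b i) = H i"
    | G H where "inj G" "inj H" "\<And>i j. i < j \<Longrightarrow> g (a j, b i) = G i"
      "\<And>i j. i < j \<Longrightarrow> h (a j, b i) = H j"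
    using g_cases h_cases dep_max dep_min
    by (elim disjE exE conjE) simp_all
  then show False
  proof cases
    case (1 G H)
    have "inj_on (\<lambda>(i, j). f (G j, H i)) {(i, j). i < j}"
      using k_inj by (rule inj_on_cong[THEN iffD1, rotated]) (auto simp: 1)
    then obtain R1 R2 where "infinite R1" "infinite R2" "inj_on f (Delta R1 R2)"
      by (rule inj_on_Delta_if_separated[OF 1(1,2)])
    then show False using not_inj_on_Delta[OF f] by blast
  next
    case (2 G H)
    \<comment> \<open>Here \<open>g\<close> carries the smaller index, so the arguments of
      \<open>f\<close> are swapped and the contradiction arises on \<open>Nabla\<close>.\<close>
    have "inj_on (\<lambda>(i, j). (f \<circ> prod.swap) (H j, G i)) {(i, j). i < j}"
      using k_inj by (rule inj_on_cong[THEN iffD1, rotated]) (auto simp: 2)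
    then obtain R1 R2 where "infinite R1" "infinite R2" "inj_on (f \<circ> prod.swap) (Delta R1 R2)"
      by (rule inj_on_Delta_if_separated[OF 2(2,1)])
    then show False using not_inj_on_Nabla[OF f] unfolding inj_on_Delta_swap by blast
  qed
qed

lemma comp_in_T2:
  assumes "f \<in> T1 \<inter> T2" "g \<in> T1 \<inter> T2" "h \<in> T1 \<inter> T2"
  shows "(\<lambda>z. f (g z, h z)) \<in> T2"
proof -
  have "\<not> inj_on (\<lambda>z. f (g z, h z)) (Delta S1 S2)"
    "\<not> inj_on (\<lambda>z. f (g z, h z)) (Nabla S1 S2)" if inf: "infinite S1" "infinite S2" for S1 S2
  proof -
    show "\<not> inj_on (\<lambda>z. f (g z, h z)) (Delta S1 S2)"
      by (rule comp_not_inj_on_Delta[OF assms inf])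
    have "g \<circ> prod.swap \<in> T1 \<inter> T2" "h \<circ> prod.swap \<in> T1 \<inter> T2"
      using assms T1_swap T2_swap by blast+
    from comp_not_inj_on_Delta[OF assms(1) this inf(2,1)]
    have "\<not> inj_on ((\<lambda>z. f (g z, h z)) \<circ> prod.swap) (Delta S2 S1)"
      by (simp add: comp_def)
    then show "\<not> inj_on (\<lambda>z. f (g z, h z)) (Nabla S1 S2)"
      unfolding inj_on_Delta_swap .
  qed
  then show ?thesis unfolding T2_def nowhere_injective_def canonical_on_def by blast
qed

section \<open>Almost unary functions under composition\<close>

lemma bounded_by_T1:
  fixes F :: "nat \<Rightarrow> nat"
  assumes "\<And>z. k z \<le> F (e z)" "e \<in> T1"
  shows "k \<in> T1"
proof -
  \<comment> \<open>A monotone majorant of \<open>F\<close>: a bound on \<open>e z\<close> then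
    yields one on \<open>F (e z)\<close>.\<close>
  define M where "M n = (\<Sum>i\<le>n. F i)" for n
  have le_M: "k z \<le> M m" if "e z \<le> m" for z m
  proof -
    have "F (e z) \<le> M m"
      unfolding M_def by (rule member_le_sum) (use that in auto)
    with assms(1)[of z] show ?thesis by linarith
  qed
  consider E where "\<And>x y. e (x, y) \<le> E x" | E where "\<And>x y. e (x, y) \<le> E y"
    using assms(2) unfolding T1_def almost_unary_def by blast
  then show ?thesis
  proof cases
    case (1 E)
    then have "\<forall>x y. k (x, y) \<le> M (E x)" using le_M by blast
    then show ?thesis
      unfolding T1_def almost_unary_def mem_Collect_eq
      by (intro disjI1 exI[of _ "\<lambda>x. M (E x)"])
  next
    case (2 E)
    then have "\<forall>x y. k (x, y) \<le> M (E y)" using le_M by blast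
    then show ?thesis
      unfolding T1_def almost_unary_def mem_Collect_eq
      by (intro disjI2 exI[of _ "\<lambda>x. M (E x)"])
  qed
qed

text \<open>\<open>f\<close> is bounded in one of its arguments, and the almost unary function
  substituted there bounds the composition.\<close>

lemma comp_in_T1:
  assumes "f \<in> T1" "g \<in> T1" "h \<in> T1"
  shows "(\<lambda>z. f (g z, h z)) \<in> T1"
proof -
  consider F where "\<And>x y. f (x, y) \<le> F x" | F where "\<And>x y. f (x, y) \<le> F y"
    using assms(1) unfolding T1_def almost_unary_def by blast
  then show ?thesis
    by cases (rule bounded_by_T1[OF _ assms(2)] bounded_by_T1[OF _ assms(3)]; assumption)+
qed

lemma essentially_unary_subset_T1: "essentially_unary \<subseteq> T1"
proof
  fix f assume "f \<in> essentially_unary"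
  then obtain u where "(\<forall>x y. f (x, y) = u x) \<or> (\<forall>x y. f (x, y) = u y)"
    unfolding essentially_unary_def by blast
  then have "(\<forall>x y. f (x, y) \<le> u x) \<or> (\<forall>x y. f (x, y) \<le> u y)" by auto
  then show "f \<in> T1" unfolding T1_def almost_unary_def by blast
qed

text \<open>Each half plane contains two points with equal first and two with equal second
  coordinate; an essentially unary function repeats a value on one of these pairs.\<close>

lemma essentially_unary_subset_T2: "essentially_unary \<subseteq> T2"
proof
  fix f assume "f \<in> essentially_unary"
  then obtain u where u: "(\<forall>x y. f (x, y) = u x) \<or> (\<forall>x y. f (x, y) = u y)"
    unfolding essentially_unary_def by blast
  have "\<not> inj_on f (Delta S1 S2) \<and> \<not> inj_on f (Nabla S1 S2)" if "infinite S1" "infinite S2" for S1 S2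
  proof -
    obtain a b where ab: "interleaved a b" "\<And>i. a i \<in> S1" "\<And>i. b i \<in> S2"
      using interleaved_exists[OF \<open>infinite S1\<close> \<open>infinite S2\<close>] by blast
    have less: "a i < b j \<longleftrightarrow> i \<le> j" "b j < a i \<longleftrightarrow> j < i" for i j
      using ab(1) unfolding interleaved_def by auto
    have neq: "a 0 \<noteq> a 1" "a 2 \<noteq> a 3" "b 0 \<noteq> b 1" "b 2 \<noteq> b 3"
      using interleaved_strict_mono[OF ab(1)] by (simp_all add: strict_mono_eq)
    have "(a 2, b 0) \<in> Delta S1 S2" "(a 2, b 1) \<in> Delta S1 S2" "(a 3, b 0) \<in> Delta S1 S2"
      "(a 0, b 2) \<in> Nabla S1 S2" "(a 0, b 3) \<in> Nabla S1 S2" "(a 1, b 2) \<in> Nabla S1 S2"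
      using ab(2,3) less unfolding Delta_def Nabla_def by simp_all
    moreover have "f (a 2, b 0) = f (a 2, b 1) \<and> f (a 0, b 2) = f (a 0, b 3) \<or>
      f (a 2, b 0) = f (a 3, b 0) \<and> f (a 0, b 2) = f (a 1, b 2)"
      using u by auto
    ultimately show ?thesis using neq unfolding inj_on_def by blast
  qed
  then show "f \<in> T2" unfolding T2_def nowhere_injective_def canonical_on_def by blast
qed

lemma binary_clone_T1_Int_T2: "binary_clone (T1 \<inter> T2)"
proof -
  have "fst \<in> essentially_unary" "snd \<in> essentially_unary"
    unfolding essentially_unary_def by auto
  then show ?thesis
    unfolding binary_clone_def
    using essentially_unary_subset_T1 essentially_unary_subset_T2 comp_in_T1 comp_in_T2
    by (auto simp: case_prod_beta')
qed

text \<open>The pairing function, set to \<open>0\<close> outside \<open>Delta\<close>, is a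
  witness: only finitely many \<open>y\<close> lie below \<open>x\<close>, so it is bounded in terms
  of \<open>x\<close>.\<close>

lemma T1_not_subset_T2: "\<not> T1 \<subseteq> T2"
proof -
  define f :: binop where "f = (\<lambda>(x, y). if y < x then prod_encode (x, y) else 0)"
  have "f (x, y) \<le> (\<Sum>y<x. prod_encode (x, y))" for x y
    using member_le_sum[of y "{..<x}" "\<lambda>y. prod_encode (x, y)"] unfolding f_def by simp
  then have "f \<in> T1"
    unfolding T1_def almost_unary_def mem_Collect_eq
    by (intro disjI1 exI[of _ "\<lambda>x. \<Sum>y<x. prod_encode (x, y)"]) blast
  moreover have "inj_on f (Delta UNIV UNIV)"
    unfolding f_def Delta_def by (auto intro!: inj_onI)
  ultimately show ?thesis
    using not_T2_if_inj_on_Delta[of f UNIV UNIV] infinite_UNIV_nat by blast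
qed

section \<open>Generating the almost unary functions\<close>

lemma clone_comp:
  assumes "binary_clone C" "f \<in> C" "g \<in> C" "h \<in> C"
  shows "(\<lambda>(x, y). f (g (x, y), h (x, y))) \<in> C"
  using assms unfolding binary_clone_def by simp

text \<open>The assumption says that \<open>h\<close> is constant on the fibres of \<open>g\<close>,
  so \<open>h\<close> is \<open>g\<close> followed by a unary function, and the clone contains all
  of those.\<close>

lemma clone_factor:
  assumes C: "binary_clone C" "essentially_unary \<subseteq> C" and g: "g \<in> C"
    and factor: "\<And>x y x' y'. g (x, y) = g (x', y') \<Longrightarrow> h (x, y) = h (x', y')"
  shows "h \<in> C"
proof -
  define u where "u n = h (SOME z. g z = n)" for n
  have u: "u (g z) = h z" for z
  proof -
    have "g (SOME z'. g z' = g z) = g z"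
      by (rule someI[of "\<lambda>z'. g z' = g z"]) (rule refl)
    then show ?thesis
      unfolding u_def
      using factor[of "fst (SOME z'. g z' = g z)" "snd (SOME z'. g z' = g z)" "fst z" "snd z"] by simp
  qed
  have "(\<lambda>(x, y). u x) \<in> essentially_unary"
    unfolding essentially_unary_def by auto
  then have "(\<lambda>(x, y). (\<lambda>(x, y). u x) (g (x, y), g (x, y))) \<in> C"
    using C by (intro clone_comp[OF C(1) _ g g]) auto
  also have "(\<lambda>(x, y). (\<lambda>(x, y). u x) (g (x, y), g (x, y))) = h"
    using u by auto
  finally show ?thesis .
qed

text \<open>The values of \<open>g\<close> above the diagonal are decoded from \<open>p (y, x)\<close>, those on and below it from
  \<open>p (x + 1, y)\<close>; both parts are bounded in terms of \<open>x\<close>, so they can be paired by \<open>p\<close> once the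
  first argument is made large.\<close>

lemma clone_generates_bounded:
  assumes C: "binary_clone C" "essentially_unary \<subseteq> C" and p: "p \<in> C"
    and inj: "\<And>x y x' y'. y < x \<Longrightarrow> y' < x' \<Longrightarrow> p (x, y) = p (x', y') \<Longrightarrow> x = x' \<and> y = y'"
    and disj: "\<And>x y x' y'. y < x \<Longrightarrow> x' \<le> y' \<Longrightarrow> p (x, y) \<noteq> p (x', y')"
    and bound: "\<And>x y. g (x, y) \<le> H x"
  shows "g \<in> C"
proof -
  note factor = clone_factor[OF C] and comp = clone_comp[OF C(1)]
  have fst: "fst \<in> C" and snd: "snd \<in> C"
    using C(1) unfolding binary_clone_def by blast+
  have unary: "(\<lambda>(x, y). u x) \<in> C" for u :: "nat \<Rightarrow> nat"
    by (rule factor[OF fst]) auto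
  define A where "A = (\<lambda>(x, y). if x < y then g (x, y) else 0)"
  define B where "B = (\<lambda>(x, y). if x < y then 0 else g (x, y))"
  have "(\<lambda>(x, y). p (y, x)) \<in> C"
    using comp[OF p snd fst] by simp
  then have "A \<in> C"
  proof (rule factor)
    fix x y x' y' assume "(\<lambda>(x, y). p (y, x)) (x, y) = (\<lambda>(x, y). p (y, x)) (x', y')"
    then show "A (x, y) = A (x', y')"
      using inj[of x y x' y'] disj[of x y y' x'] disj[of x' y' y x] unfolding A_def by fastforce
  qed
  \<comment> \<open>The successor turns \<open>y \<le> x\<close> into \<open>y < Suc x\<close>,
    which brings the diagonal into the injective half plane, and \<open>x < y\<close> into
    \<open>Suc x \<le> y\<close>.\<close>
  have "(\<lambda>(x, y). p (Suc x, y)) \<in> C"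
    using comp[OF p unary[of Suc] snd] by simp
  then have "B \<in> C"
  proof (rule factor)
    fix x y x' y' assume "(\<lambda>(x, y). p (Suc x, y)) (x, y) = (\<lambda>(x, y). p (Suc x, y)) (x', y')"
    then show "B (x, y) = B (x', y')"
      using inj[of y "Suc x" y' "Suc x'"] disj[of y "Suc x" "Suc x'" y'] disj[of y' "Suc x'" "Suc x" y]
      unfolding B_def by fastforce
  qed
  have AB: "A (x, y) \<le> H x" "B (x, y) \<le> H x" "g (x, y) = A (x, y) + B (x, y)" for x y
    using bound unfolding A_def B_def by auto
  \<comment> \<open>\<open>L x\<close> determines \<open>x\<close> and exceeds \<open>H x\<close>,
    hence \<open>A (x, y)\<close>; so \<open>p (L x, A (x, y))\<close> determines both
    \<open>x\<close> and \<open>A (x, y)\<close>.\<close>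
  define L where "L x = prod_encode (x, Suc (H x))" for x
  have L: "A (x, y) < L x" "L x = L x' \<longleftrightarrow> x = x'" for x y x'
    using AB(1)[of x y] le_prod_encode_2[of "Suc (H x)" x] unfolding L_def by auto
  \<comment> \<open>\<open>Q\<close> determines \<open>A\<close>, and its component
    \<open>Suc (H x)\<close> makes it exceed \<open>B\<close>. So
    \<open>p (Q (x, y), B (x, y))\<close> determines \<open>A\<close> and \<open>B\<close>, whose
    sum is \<open>g\<close>.\<close>
  define Q where "Q = (\<lambda>(x, y). prod_encode (Suc (H x), A (x, y)))"
  have "(\<lambda>(x, y). p (L x, A (x, y))) \<in> C"
    using comp[OF p unary[of L] \<open>A \<in> C\<close>] by simp
  then have "Q \<in> C"
  proof (rule factor)
    fix x y x' y' assume "(\<lambda>(x, y). p (L x, A (x, y))) (x, y) = (\<lambda>(x, y). p (L x, A (x, y))) (x', y')"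
    then show "Q (x, y) = Q (x', y')"
      using inj[of "A (x, y)" "L x" "A (x', y')" "L x'"] L unfolding Q_def by auto
  qed
  have Q: "B (x, y) < Q (x, y)" for x y
    using AB(2)[of x y] le_prod_encode_1[of "Suc (H x)" "A (x, y)"] unfolding Q_def by simp
  have "(\<lambda>(x, y). p (Q (x, y), B (x, y))) \<in> C"
    by (rule comp[OF p \<open>Q \<in> C\<close> \<open>B \<in> C\<close>])
  then show "g \<in> C"
  proof (rule factor)
    fix x y x' y'
    assume "(\<lambda>(x, y). p (Q (x, y), B (x, y))) (x, y) = (\<lambda>(x, y). p (Q (x, y), B (x, y))) (x', y')"
    then have "Q (x, y) = Q (x', y')" "B (x, y) = B (x', y')"
      using inj[of "B (x, y)" "Q (x, y)" "B (x', y')" "Q (x', y')"] Q by auto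
    then show "g (x, y) = g (x', y')"
      unfolding AB(3) Q_def by simp
  qed
qed

lemma clone_swap:
  assumes "binary_clone C" "f \<in> C"
  shows "f \<circ> prod.swap \<in> C"
proof -
  have "fst \<in> C" "snd \<in> C"
    using assms(1) unfolding binary_clone_def by blast+
  then have "(\<lambda>(x, y). f (snd (x, y), fst (x, y))) \<in> C"
    using assms by (intro clone_comp)
  also have "(\<lambda>(x, y). f (snd (x, y), fst (x, y))) = f \<circ> prod.swap" by auto
  finally show ?thesis .
qed

text \<open>A row in \<open>Nabla\<close> is infinite but \<open>f\<close> is bounded on it, so
  \<open>f\<close> is not injective on \<open>Nabla\<close>. This excludes the symmetric alternative
  of canonicity, and the values on the two half planes are disjoint, as
  \<open>clone_generates_bounded\<close> requires.\<close>

lemma T1_subset_clone_if_inj_on_Delta: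
  assumes C: "binary_clone C" "essentially_unary \<subseteq> C" and f: "f \<in> C" "f \<in> T1"
    and canonical: "canonical_on S1 S2 f" and inj: "inj_on f (Delta S1 S2)"
  shows "T1 \<subseteq> C"
proof -
  have inf: "infinite S1" "infinite S2"
    using canonical unfolding canonical_on_def by blast+
  obtain F where F: "\<And>x y. f (x, y) \<le> F x"
    using bounded_by_first_if_inj_on_Delta[OF f(2) inf inj] by blast
  have "\<not> inj_on f (Nabla S1 S2)"
  proof
    assume Nabla_inj: "inj_on f (Nabla S1 S2)"
    obtain x where "x \<in> S1" using inf(1) infinite_imp_nonempty by blast
    then have "inj_on (\<lambda>y. f (x, y)) {y \<in> S2. x < y}"
      using Nabla_inj unfolding inj_on_def Nabla_def by auto
    then show False
      using no_bounded_injective_row[OF inf(2), of "\<lambda>y. f (x, y)" "F x"] F by simp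
  qed
  moreover have "inj_on f (Nabla S1 S2)" if "S1 = S2" "\<forall>x\<in>S1. \<forall>y\<in>S1. f (x, y) = f (y, x)"
  proof -
    have "inj_on (f \<circ> prod.swap) (Delta S1 S2) \<longleftrightarrow> inj_on f (Delta S1 S2)"
      by (rule inj_on_cong) (use that in \<open>auto simp: Delta_def\<close>)
    then show ?thesis using inj that(1) inj_on_Delta_swap by blast
  qed
  ultimately have disj: "f ` Delta S1 S2 \<inter> f ` Nabla S1 S2 = {}"
    using canonical unfolding canonical_on_def by blast
  obtain a b where ab: "interleaved a b" "\<And>i. a i \<in> S1" "\<And>i. b i \<in> S2"
    using interleaved_exists[OF inf] by blast
  have in_Delta: "(a i, b j) \<in> Delta S1 S2" if "j < i" for i j
    using ab that unfolding interleaved_def Delta_def by simp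
  have in_Nabla: "(a i, b j) \<in> Nabla S1 S2" if "i \<le> j" for i j
    using ab that unfolding interleaved_def Nabla_def by simp
  \<comment> \<open>Interleaving sends the pairs \<open>y < x\<close> into \<open>Delta\<close> and
    all others, including the diagonal, into \<open>Nabla\<close>.\<close>
  define p where "p = (\<lambda>(x, y). f (a x, b y))"
  have "(\<lambda>(x, y). a x) \<in> C" "(\<lambda>(x, y). b y) \<in> C"
    using C(2) unfolding essentially_unary_def by auto
  from clone_comp[OF C(1) f(1) this] have p: "p \<in> C"
    unfolding p_def by simp
  have p_inj: "x = x' \<and> y = y'" if "y < x" "y' < x'" "p (x, y) = p (x', y')" for x y x' y'
  proof -
    have "(a x, b y) = (a x', b y')"
      by (rule inj_onD[OF inj]) (use that in_Delta in \<open>auto simp: p_def\<close>)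
    then show ?thesis
      using interleaved_strict_mono[OF ab(1)] by (simp add: strict_mono_eq)
  qed
  have p_disj: "p (x, y) \<noteq> p (x', y')" if "y < x" "x' \<le> y'" for x y x' y'
    using disj in_Delta[OF that(1)] in_Nabla[OF that(2)] unfolding p_def by auto
  have bounded: "g \<in> C" if "\<And>x y. g (x, y) \<le> H x" for g H
    using C p p_inj p_disj
  proof (rule clone_generates_bounded)
    show "g (x, y) \<le> H x" for x y by (rule that)
  qed
  show ?thesis
  proof
    fix g assume "g \<in> T1"
    then consider H where "\<forall>x y. g (x, y) \<le> H x" | H where "\<forall>x y. g (x, y) \<le> H y"
      unfolding T1_def almost_unary_def by blast
    then show "g \<in> C"
    proof cases
      case (1 H)
      then show ?thesis by (intro bounded[of g H]) simp
    next
      case (2 H)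
      have "g \<circ> prod.swap \<in> C"
        by (rule bounded[of _ H]) (simp add: 2)
      from clone_swap[OF C(1) this] show ?thesis unfolding swap_swap .
    qed
  qed
qed

section \<open>The dichotomy and the coatom\<close>

lemma clone_eq_T1_or_subset_T2:
  assumes C: "binary_clone C" "essentially_unary \<subseteq> C" "C \<subseteq> T1"
  shows "C = T1 \<or> C \<subseteq> T2"
proof (rule disjCI)
  assume "\<not> C \<subseteq> T2"
  then obtain f S1 S2 where f: "f \<in> C" "canonical_on S1 S2 f"
    "inj_on f (Delta S1 S2) \<or> inj_on f (Nabla S1 S2)"
    unfolding T2_def nowhere_injective_def by blast
  from f(3) have "T1 \<subseteq> C"
  proof
    assume "inj_on f (Delta S1 S2)"
    with f(1,2) C show ?thesis
      by (intro T1_subset_clone_if_inj_on_Delta[of C f S1 S2]) auto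
  next
    assume "inj_on f (Nabla S1 S2)"
    moreover have "f \<circ> prod.swap \<in> C" using clone_swap[OF C(1) f(1)] .
    moreover have "canonical_on S2 S1 (f \<circ> prod.swap)" using canonical_on_swap[OF f(2)] .
    ultimately show ?thesis
      using C by (intro T1_subset_clone_if_inj_on_Delta[of C "f \<circ> prod.swap" S2 S1])
        (auto simp: inj_on_Delta_swap)
  qed
  with C(3) show "C = T1" by blast
qed

theorem mainTheorem2:
  shows "(\<forall>C. binary_clone C \<and> essentially_unary \<subseteq> C \<and> C \<subseteq> T1 \<longrightarrow> C = T1 \<or> C \<subseteq> T2) \<and>
    coatom_in_interval essentially_unary T1 (T1 \<inter> T2) \<and>
    (\<forall>M. coatom_in_interval essentially_unary T1 M \<longrightarrow> M = T1 \<inter> T2) \<and>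
    (\<forall>C \<in> clone_interval essentially_unary T1. C \<noteq> T1 \<longrightarrow> C \<subseteq> T1 \<inter> T2)"
proof -
  let ?I = "clone_interval essentially_unary T1"
  \<comment> \<open>By the dichotomy \<open>T1 \<inter> T2\<close> bounds every clone of the
    interval other than \<open>T1\<close>. As it is itself such a clone, it is the largest and
    therefore the only maximal one.\<close>
  have below: "C \<subseteq> T1 \<inter> T2" if "C \<in> ?I" "C \<noteq> T1" for C
    using that clone_eq_T1_or_subset_T2[of C] unfolding clone_interval_def by blast
  have "T1 \<inter> T2 \<in> ?I - {T1}"
    using binary_clone_T1_Int_T2 essentially_unary_subset_T1 essentially_unary_subset_T2
      T1_not_subset_T2
    unfolding clone_interval_def by blast
  with below have "coatom_in_interval essentially_unary T1 (T1 \<inter> T2)"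
    unfolding coatom_in_interval_def by blast
  moreover have "M = T1 \<inter> T2" if "coatom_in_interval essentially_unary T1 M" for M
    using that below \<open>T1 \<inter> T2 \<in> ?I - {T1}\<close> unfolding coatom_in_interval_def by blast
  moreover have "C = T1 \<or> C \<subseteq> T2"
    if "binary_clone C \<and> essentially_unary \<subseteq> C \<and> C \<subseteq> T1" for C
    using that clone_eq_T1_or_subset_T2[of C] by simp
  ultimately show ?thesis
    using below by (intro conjI allI impI ballI) assumption+
qed

end
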